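(* Let $n\ge1$ and let $r$ be an even integer with $0\le r\le n-1$. For $T>0$ let $N_{n,r}(T)=\#\{A\in\mathrm{M}_n(\mathbb{Z})_{\mathrm{alt}}:\ \operatorname{rank}A=r,\ |A|<T\}$, where $|A|=(\sum_{i,j}a_{ij}^2)^{1/2}$. Then $N_{n,r}(T)\gg_n T^{nr/2}$ for all sufficiently large real $T$.
   Context: $\mathrm{M}_n(\mathbb{Z})_{\mathrm{alt}}$ is the set of $n\times n$ integer matrices $A$ with $A^T=-A$ and zero diagonal. $f\gg_n g$ means $f\ge c(n)g$ for a positive constant $c(n)$ depending only on $n$. *)

theory Defs
  imports "HOL-Analysis.Analysis" "Jordan_Normal_Form.DL_Rank"
begin

definition alt_int_mats :: "nat \<Rightarrow> int mat set" where
  "alt_int_mats n =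
     {A \<in> carrier_mat n n. transpose_mat A = - A \<and> (\<forall>i<n. A $$ (i, i) = 0)}"

text \<open>The rank of an integer matrix is its rank over the fraction field of the integers.\<close>

definition int_mat_rank :: "int mat \<Rightarrow> nat" where
  "int_mat_rank A = vec_space.rank (dim_row A) (map_mat rat_of_int A)"

definition int_mat_norm :: "int mat \<Rightarrow> real" where
  "int_mat_norm A = sqrt (\<Sum>i<dim_row A. \<Sum>j<dim_col A. (real_of_int (A $$ (i, j)))\<^sup>2)"

definition alt_rank_count :: "nat \<Rightarrow> nat \<Rightarrow> real \<Rightarrow> nat" where
  "alt_rank_count n r T =
     card {A \<in> alt_int_mats n. int_mat_rank A = r \<and> int_mat_norm A < T}"

end

theory Submission
  imports Defs "Jordan_Normal_Form.DL_Rank_Submatrix" "HOL-Number_Theory.Cong"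
begin

text \<open>
  Let \<open>r = 2 h\<close>. The matrices \<open>A = B J B\<^sup>T\<close>, with \<open>J\<close> the standard symplectic matrix of size \<open>r\<close> and
  \<open>B\<close> an integral \<open>n \<times> r\<close> matrix of rank \<open>r\<close> with entries of size \<open>s \<approx> T\<^bsup>1/2\<^esup>\<close>, are alternating of
  rank \<open>r\<close> and norm \<open>O(T)\<close>, and there are about \<open>T\<^bsup>n r / 2\<^esup>\<close> such \<open>B\<close>.

  If \<open>B\<close> is primitive (injective modulo every prime) and \<open>B J B\<^sup>T = B' J B'\<^sup>T\<close>, then \<open>B' = B g\<close> with
  \<open>g\<close> integral. When the upper \<open>r \<times> r\<close> blocks of \<open>B\<close> and \<open>B'\<close> are both close to the same large multiple of the
  identity, this forces \<open>g = 1\<close>. So \<open>B \<mapsto> B J B\<^sup>T\<close> is injective on primitive matrices in a suitable box.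

  It remains to see that a positive proportion of the box is primitive. Small primes are
  excluded by requiring \<open>B\<close> to be congruent to \<open>(1; 0)\<close> modulo \<open>Q!\<close>. For \<open>Q < p \<le> s\<close> the
  proportion of matrices with a kernel vector modulo \<open>p\<close> is \<open>O(1/p\<^sup>2)\<close>, because \<open>r < n\<close>. For \<open>p > s\<close>, look at
  the first leading \<open>(a + 2) \<times> (a + 1)\<close> block that is not injective modulo \<open>p\<close>: its kernel is a line
  already determined by its first \<open>a + 1\<close> rows, \<open>p\<close> is one of the at most \<open>a + 1\<close> large prime divisors of a
  nonzero minor, and hence the last entry of the block is determined by the other ones up to
  \<open>O(1)\<close> choices.
\<close>

section \<open>Injectivity modulo integers\<close>

text \<open>Matrices are functions on index pairs, so passing to a leading block only changes
  \<open>m\<close> and \<open>k\<close>.\<close>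

definition inj_mod :: "int \<Rightarrow> nat \<Rightarrow> nat \<Rightarrow> (nat \<Rightarrow> nat \<Rightarrow> int) \<Rightarrow> bool" where
  "inj_mod d m k B \<longleftrightarrow>
     (\<forall>u. (\<forall>i<m. d dvd (\<Sum>j<k. B i j * u j)) \<longrightarrow> (\<forall>j<k. d dvd u j))"

lemma inj_modD:
  assumes "inj_mod d m k B" "\<And>i. i < m \<Longrightarrow> d dvd (\<Sum>j<k. B i j * u j)" "j < k"
  shows "d dvd u j"
  using assms(1)[unfolded inj_mod_def, rule_format, of u, OF assms(2,3)] .

text \<open>Injectivity modulo \<open>a\<close> makes the quotient of \<open>u\<close> by
  \<open>a\<close> integral; this quotient is then a kernel vector modulo \<open>b\<close>.\<close>

lemma inj_mod_mult:
  assumes "inj_mod a m k B" "inj_mod b m k B" "a \<noteq> 0"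
  shows "inj_mod (a * b) m k B"
  unfolding inj_mod_def
proof (intro allI impI)
  fix u j assume u: "\<forall>i<m. a * b dvd (\<Sum>j<k. B i j * u j)" and j: "j < k"
  have "a dvd u j" if "j < k" for j
    by (rule inj_modD[OF assms(1) _ that]) (use u dvd_mult_left in blast)
  then have v: "u j = a * (u j div a)" if "j < k" for j
    using that by simp
  have "b dvd (\<Sum>j<k. B i j * (u j div a))" if "i < m" for i
  proof -
    have "(\<Sum>j<k. B i j * u j) = (\<Sum>j<k. a * (B i j * (u j div a)))"
    proof (rule sum.cong)
      fix j assume "j \<in> {..<k}"
      then show "B i j * u j = a * (B i j * (u j div a))"
        using v[of j] by (metis lessThan_iff mult.left_commute)
    qed simp
    also have "\<dots> = a * (\<Sum>j<k. B i j * (u j div a))"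
      by (simp add: sum_distrib_left)
    finally have "a * b dvd a * (\<Sum>j<k. B i j * (u j div a))" using u that by metis
    then show ?thesis using assms(3) by simp
  qed
  then have "b dvd u j div a"
    by (rule inj_modD[OF assms(2) _ j])
  then show "a * b dvd u j"
    by (subst v[OF j]) (intro mult_dvd_mono dvd_refl)
qed

text \<open>Primitivity is tested at primes but gets applied modulo a determinant, hence the passage
  through prime factorizations.\<close>

lemma inj_mod_if_prime:
  assumes "\<And>p. prime p \<Longrightarrow> inj_mod p m k B" and "d \<noteq> 0"
  shows "inj_mod d m k B"
  using assms(2)
proof (induction d rule: prime_divisors_induct)
  case (unit x)
  then show ?case by (auto simp: inj_mod_def intro: unit_imp_dvd)
next
  case (factor p x)
  then show ?case by (intro inj_mod_mult[OF assms(1)]) auto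
qed simp

lemma inj_mod_mono:
  assumes "inj_mod d m k B" "m \<le> m'"
  shows "inj_mod d m' k B"
  unfolding inj_mod_def
proof (intro allI impI)
  fix u j assume "\<forall>i<m'. d dvd (\<Sum>j<k. B i j * u j)" "j < k"
  then show "d dvd u j" using assms(2) by (intro inj_modD[OF assms(1), of u j]) auto
qed

section \<open>Determinants and adjugates of integer matrices\<close>

lemma det_cong:
  fixes A B :: "int mat"
  assumes "A \<in> carrier_mat k k" "B \<in> carrier_mat k k"
    and "\<And>i j. i < k \<Longrightarrow> j < k \<Longrightarrow> [A $$ (i, j) = B $$ (i, j)] (mod m)"
  shows "[Determinant.det A = Determinant.det B] (mod m)"
  unfolding det_def'[OF assms(1)] det_def'[OF assms(2)]
proof (intro cong_sum cong_mult cong_refl cong_prod assms(3))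
  fix p i assume "p \<in> {p. p permutes {0..<k}}" "i \<in> {0..<k}"
  then show "i < k" "p i < k" using permutes_in_image[of p "{0..<k}" i] by auto
qed

lemma abs_det_le:
  fixes A :: "int mat"
  assumes "A \<in> carrier_mat k k"
    and "\<And>i j. i < k \<Longrightarrow> j < k \<Longrightarrow> \<bar>A $$ (i, j)\<bar> \<le> b"
  shows "\<bar>Determinant.det A\<bar> \<le> fact k * b ^ k"
proof -
  have "\<bar>Determinant.det A\<bar> \<le> (\<Sum>p\<in>{p. p permutes {0..<k}}. b ^ k)"
    unfolding det_def'[OF assms(1)]
  proof (rule order_trans[OF sum_abs sum_mono])
    fix p assume p: "p \<in> {p. p permutes {0..<k}}"
    have "\<bar>\<Prod>i = 0..<k. A $$ (i, p i)\<bar> \<le> (\<Prod>i = 0..<k. b)"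
      unfolding abs_prod
      by (rule prod_mono) (use p permutes_in_image[of p "{0..<k}"] in \<open>auto intro!: assms(2)\<close>)
    then show "\<bar>signof p * (\<Prod>i = 0..<k. A $$ (i, p i))\<bar> \<le> b ^ k"
      by (simp add: abs_mult sign_def)
  qed
  also have "\<dots> = fact k * b ^ k"
    by (simp add: card_permutations[of "{0..<k}" k])
  finally show ?thesis .
qed

lemma adjugate_sum:
  fixes B :: "nat \<Rightarrow> nat \<Rightarrow> int"
  obtains C where "\<And>a b. a < k \<Longrightarrow> b < k \<Longrightarrow>
    (\<Sum>j<k. C a j * B j b) =
      (if a = b then Determinant.det (Matrix.mat k k (\<lambda>(i, j). B i j)) else 0)"
proof -
  define A where "A = Matrix.mat k k (\<lambda>(i, j). B i j)"
  have A: "A \<in> carrier_mat k k" by (simp add: A_def)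
  show ?thesis
  proof
    fix a b assume ab: "a < k" "b < k"
    have "(\<Sum>j<k. adj_mat A $$ (a, j) * B j b) = (adj_mat A * A) $$ (a, b)"
      using ab adj_mat(1)[OF A]
      by (auto simp: A_def scalar_prod_def lessThan_atLeast0 intro!: sum.cong)
    also have "\<dots> = (if a = b then Determinant.det A else 0)"
      using ab adj_mat(3)[OF A] by auto
    finally show "(\<Sum>j<k. adj_mat A $$ (a, j) * B j b) =
      (if a = b then Determinant.det (Matrix.mat k k (\<lambda>(i, j). B i j)) else 0)"
      by (simp add: A_def)
  qed
qed

text \<open>Multiplying \<open>B u\<close> by the adjugate gives the determinant times
  \<open>u\<close>, and coordinate \<open>a\<close> of that is the determinant itself.\<close>

lemma dvd_det_if_kernel:
  fixes B :: "nat \<Rightarrow> nat \<Rightarrow> int"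
  assumes "\<And>i. i < k \<Longrightarrow> d dvd (\<Sum>j<k. B i j * u j)" "a < k" "u a = 1"
  shows "d dvd Determinant.det (Matrix.mat k k (\<lambda>(i, j). B i j))"
proof -
  let ?D = "Determinant.det (Matrix.mat k k (\<lambda>(i, j). B i j))"
  obtain C where C: "\<And>a b. a < k \<Longrightarrow> b < k \<Longrightarrow>
    (\<Sum>j<k. C a j * B j b) = (if a = b then ?D else 0)"
    using adjugate_sum[of k B] by blast
  have "(\<Sum>i<k. C a i * (\<Sum>j<k. B i j * u j)) = (\<Sum>j<k. (\<Sum>i<k. C a i * B i j) * u j)"
    by (simp add: sum_distrib_left sum_distrib_right mult.assoc) (rule sum.swap)
  also have "\<dots> = (\<Sum>j<k. if a = j then ?D * u j else 0)"
    using C[OF assms(2)] by (intro sum.cong) auto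
  also have "\<dots> = ?D" using assms by simp
  finally have "(\<Sum>i<k. C a i * (\<Sum>j<k. B i j * u j)) = ?D" .
  moreover have "d dvd (\<Sum>i<k. C a i * (\<Sum>j<k. B i j * u j))"
    using assms(1) by (intro dvd_sum) auto
  ultimately show ?thesis by simp
qed

section \<open>Skew products and their rank\<close>

text \<open>\<open>skew_prod h B i j\<close> is the entry \<open>(i, j)\<close> of the matrix \<open>B J B\<^sup>T\<close>, where \<open>J\<close> is the
  standard symplectic matrix of size \<open>2 h\<close>; \<open>skew_dual h B\<close> is the factor \<open>J B\<^sup>T\<close>.\<close>

definition skew_prod :: "nat \<Rightarrow> (nat \<Rightarrow> nat \<Rightarrow> int) \<Rightarrow> nat \<Rightarrow> nat \<Rightarrow> int" where
  "skew_prod h B i j = (\<Sum>k<h. B i k * B j (h + k) - B i (h + k) * B j k)"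

definition skew_dual :: "nat \<Rightarrow> (nat \<Rightarrow> nat \<Rightarrow> int) \<Rightarrow> nat \<Rightarrow> nat \<Rightarrow> int" where
  "skew_dual h B k j = (if k < h then B j (h + k) else - B j (k - h))"

lemma skew_prod_eq_sum: "skew_prod h B i j = (\<Sum>k<2*h. B i k * skew_dual h B k j)"
proof -
  have "(\<Sum>k<2*h. B i k * skew_dual h B k j) =
    (\<Sum>k\<in>{0..<h}. B i k * skew_dual h B k j) + (\<Sum>k\<in>{h..<h+h}. B i k * skew_dual h B k j)"
    by (subst sum.atLeastLessThan_concat) (auto simp: lessThan_atLeast0 mult_2)
  also have "(\<Sum>k\<in>{h..<h+h}. B i k * skew_dual h B k j) =
    (\<Sum>k\<in>{0..<h}. B i (h + k) * skew_dual h B (h + k) j)"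
    using sum.shift_bounds_nat_ivl[of "\<lambda>k. B i k * skew_dual h B k j" 0 h h]
    by (simp add: add.commute)
  finally show ?thesis
    by (simp add: skew_prod_def skew_dual_def sum.distrib[symmetric] lessThan_atLeast0 sum_subtractf sum_negf)
qed

text \<open>This cancels the factor \<open>J B\<^sup>T\<close> over the integers, at the price of a
  factor \<open>det B\<close>, where \<open>B\<close> is the leading square block.\<close>

lemma skew_dual_right_inverse:
  fixes B :: "nat \<Rightarrow> nat \<Rightarrow> int"
  obtains X where "\<And>k l. k < 2*h \<Longrightarrow> l < 2*h \<Longrightarrow>
    (\<Sum>j<2*h. skew_dual h B k j * X j l) =
      (if k = l then Determinant.det (Matrix.mat (2*h) (2*h) (\<lambda>(i, j). B i j)) else 0)"
proof -
  let ?D = "Determinant.det (Matrix.mat (2*h) (2*h) (\<lambda>(i, j). B i j))"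
  obtain C where C: "\<And>a b. a < 2*h \<Longrightarrow> b < 2*h \<Longrightarrow>
    (\<Sum>j<2*h. C a j * B j b) = (if a = b then ?D else 0)"
    using adjugate_sum[of "2*h" B] by blast
  have C': "(\<Sum>j<2*h. B j b * C a j) = (if a = b then ?D else 0)" if "a < 2*h" "b < 2*h" for a b
    using C[OF that] by (simp add: mult.commute)
  \<comment> \<open>This is the transposed adjugate times \<open>J\<^sup>T\<close>, the latter being
    the inverse of \<open>J\<close>.\<close>
  define X where "X j l = (if l < h then C (h + l) j else - C (l - h) j)" for j l
  show ?thesis
  proof
    fix k l assume kl: "k < 2*h" "l < 2*h"
    show "(\<Sum>j<2*h. skew_dual h B k j * X j l) = (if k = l then ?D else 0)"
      using kl by (cases "k < h"; cases "l < h") (auto simp: skew_dual_def X_def C' sum_negf)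
  qed
qed

text \<open>At an index \<open>i\<close> where a nonzero integral \<open>u\<close> has maximal
  absolute value, dominance gives row \<open>i\<close> of \<open>B u\<close> absolute value at least
  \<open>e * \<bar>u i\<bar>\<close>, hence at least \<open>e\<close>.\<close>

lemma diag_dominant_kernel:
  fixes B :: "nat \<Rightarrow> nat \<Rightarrow> int"
  assumes dom: "\<And>i. i < r \<Longrightarrow> (\<Sum>k\<in>{..<r} - {i}. \<bar>B i k\<bar>) + e \<le> \<bar>B i i\<bar>"
    and small: "\<And>i. i < r \<Longrightarrow> \<bar>\<Sum>k<r. B i k * u k\<bar> < e"
    and "k < r"
  shows "u k = 0"
proof (rule ccontr)
  assume "u k \<noteq> 0"
  obtain i where i: "i < r" and mx: "\<And>j. j < r \<Longrightarrow> \<bar>u j\<bar> \<le> \<bar>u i\<bar>"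
    using obtains_MAX[of "{..<r}" "\<lambda>j. \<bar>u j\<bar>"] \<open>k < r\<close>
    by (metis Max_ge empty_iff finite_imageI finite_lessThan image_eqI lessThan_iff)
  have ui: "1 \<le> \<bar>u i\<bar>" using mx[OF \<open>k < r\<close>] \<open>u k \<noteq> 0\<close> by linarith
  have e: "0 < e" using small[OF i] by linarith
  let ?R = "\<Sum>k\<in>{..<r} - {i}. B i k * u k"
  have "\<bar>?R\<bar> \<le> (\<Sum>k\<in>{..<r} - {i}. \<bar>B i k\<bar> * \<bar>u i\<bar>)"
    by (rule order_trans[OF sum_abs]) (auto intro!: sum_mono mult_left_mono mx simp: abs_mult)
  also have "\<dots> = (\<Sum>k\<in>{..<r} - {i}. \<bar>B i k\<bar>) * \<bar>u i\<bar>"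
    by (simp add: sum_distrib_right)
  also have "\<dots> \<le> (\<bar>B i i\<bar> - e) * \<bar>u i\<bar>"
    using dom[OF i] by (intro mult_right_mono) auto
  finally have R: "\<bar>?R\<bar> \<le> \<bar>B i i * u i\<bar> - e * \<bar>u i\<bar>"
    by (simp add: algebra_simps abs_mult)
  have "e * 1 \<le> e * \<bar>u i\<bar>" using ui e by (intro mult_left_mono) auto
  moreover have "(\<Sum>k<r. B i k * u k) = B i i * u i + ?R"
    using i by (simp add: sum.remove)
  ultimately show False using R small[OF i] by linarith
qed

text \<open>Cancelling \<open>J B'\<^sup>T\<close> up to its determinant \<open>D\<close> gives
  \<open>B G = D B'\<close>. Primitivity of \<open>B\<close> makes \<open>G\<close> divisible by
  \<open>D\<close>, so \<open>B' = B g\<close> with \<open>g\<close> integral, and diagonal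
  dominance then forces \<open>g = 1\<close>. The proof treats one column \<open>l\<close> at a
  time.\<close>

lemma skew_prod_eq_imp_eq:
  fixes B B' :: "nat \<Rightarrow> nat \<Rightarrow> int"
  assumes eq: "\<And>i j. i < n \<Longrightarrow> j < n \<Longrightarrow> skew_prod h B i j = skew_prod h B' i j"
    and hn: "2*h \<le> n"
    and det: "Determinant.det (Matrix.mat (2*h) (2*h) (\<lambda>(i, j). B' i j)) \<noteq> 0"
    and prim: "\<And>d. d \<noteq> 0 \<Longrightarrow> inj_mod d n (2*h) B"
    and dom: "\<And>i. i < 2*h \<Longrightarrow> (\<Sum>k\<in>{..<2*h} - {i}. \<bar>B i k\<bar>) + e \<le> \<bar>B i i\<bar>"
    and small: "\<And>i j. i < 2*h \<Longrightarrow> j < 2*h \<Longrightarrow> \<bar>B' i j - B i j\<bar> < e"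
    and il: "i < n" "l < 2*h"
  shows "B' i l = B i l"
proof -
  define D where "D = Determinant.det (Matrix.mat (2*h) (2*h) (\<lambda>(i, j). B' i j))"
  obtain X where X: "\<And>k l. k < 2*h \<Longrightarrow> l < 2*h \<Longrightarrow>
    (\<Sum>j<2*h. skew_dual h B' k j * X j l) = (if k = l then D else 0)"
    unfolding D_def using skew_dual_right_inverse[of h B'] by blast
  \<comment> \<open>Column \<open>l\<close> of \<open>J B\<^sup>T X\<close>: the dual factor comes
    from \<open>B\<close>, whereas \<open>X\<close> was built from \<open>B'\<close>.\<close>
  define G where "G k = (\<Sum>j<2*h. skew_dual h B k j * X j l)" for k
  have swap: "(\<Sum>j<2*h. skew_prod h C i j * X j l) =
    (\<Sum>k<2*h. C i k * (\<Sum>j<2*h. skew_dual h C k j * X j l))" for C i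
    unfolding skew_prod_eq_sum
    by (simp add: sum_distrib_left sum_distrib_right mult.assoc) (rule sum.swap)
  have BG: "(\<Sum>k<2*h. B i k * G k) = D * B' i l" if "i < n" for i
  proof -
    have "(\<Sum>k<2*h. B i k * G k) = (\<Sum>j<2*h. skew_prod h B i j * X j l)"
      unfolding swap G_def ..
    also have "\<dots> = (\<Sum>j<2*h. skew_prod h B' i j * X j l)"
      using eq that hn by (intro sum.cong) auto
    also have "\<dots> = (\<Sum>k<2*h. if k = l then D * B' i k else 0)"
      unfolding swap using X il by (intro sum.cong) auto
    also have "\<dots> = D * B' i l" using il by simp
    finally show ?thesis .
  qed
  have "D dvd G k" if "k < 2*h" for k
    by (rule inj_modD[OF prim _ that]) (use det BG in \<open>auto simp: D_def\<close>)
  then have G: "G k = D * (G k div D)" if "k < 2*h" for k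
    using that by simp
  define g where "g k = G k div D" for k
  have Bg: "(\<Sum>k<2*h. B i k * g k) = B' i l" if "i < n" for i
  proof -
    have "D * (\<Sum>k<2*h. B i k * g k) = (\<Sum>k<2*h. B i k * G k)"
      unfolding sum_distrib_left
    proof (rule sum.cong)
      fix k assume "k \<in> {..<2*h}"
      then have "G k = D * g k" using G[of k] unfolding g_def by blast
      then show "D * (B i k * g k) = B i k * G k" by simp
    qed simp
    then show ?thesis using BG[OF that] det unfolding D_def[symmetric] by simp
  qed
  \<comment> \<open>Column \<open>l\<close> of \<open>g - 1\<close>; \<open>B\<close> maps it to
    column \<open>l\<close> of \<open>B' - B\<close>, which is small in the first \<open>2*h\<close>
    rows.\<close>
  define u where "u k = g k - (if k = l then 1 else 0)" for k
  have Bu: "(\<Sum>k<2*h. B i k * u k) = B' i l - B i l" if "i < n" for i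
  proof -
    have "(\<Sum>k<2*h. B i k * u k) = (\<Sum>k<2*h. B i k * g k) - (\<Sum>k<2*h. if k = l then B i k else 0)"
      unfolding u_def sum_subtractf[symmetric] by (intro sum.cong) (auto simp: algebra_simps)
    then show ?thesis using Bg[OF that] il by simp
  qed
  have "u k = 0" if "k < 2*h" for k
    by (rule diag_dominant_kernel[OF dom _ that]) (use Bu small il hn in auto)
  then show ?thesis using Bu[OF il(1)] by simp
qed

section \<open>Rank of the skew product\<close>

lemma rank_sum_products_le:
  fixes f g :: "nat \<Rightarrow> nat \<Rightarrow> 'a::field"
  shows "vec_space.rank n (Matrix.mat n m (\<lambda>(i, j). \<Sum>k<r. f k i * g k j)) \<le> r"
proof (induction r)
  case 0
  have eq: "Matrix.mat n m (\<lambda>(i, j). \<Sum>k<0. f k i * g k j) = 0\<^sub>m n m"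
    by (intro eq_matI) auto
  show ?case unfolding eq by (simp add: vec_space.rank_0I)
next
  case (Suc r)
  let ?A = "Matrix.mat n m (\<lambda>(i, j). \<Sum>k<r. f k i * g k j)"
  let ?C = "Matrix.mat n m (\<lambda>(i, j). f r i * g r j)"
  have "Matrix.mat n m (\<lambda>(i, j). \<Sum>k<Suc r. f k i * g k j) = ?A + ?C"
    by (intro eq_matI) auto
  moreover have "vec_space.rank n (?A + ?C) \<le> vec_space.rank n ?A + vec_space.rank n ?C"
    by (rule vec_space.rank_subadditive) auto
  moreover have "vec_space.rank n ?C \<le> 1"
    by (rule vec_space.rank_le_1_product_entries[where f = "f r" and g = "g r"]) auto
  ultimately show ?case using Suc by simp
qed

text \<open>The library bound for minors applies, since \<open>pick {..<r}\<close> is the identity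
  below \<open>r\<close>.\<close>

lemma rank_ge_leading_minor:
  fixes A :: "'a::field mat"
  assumes "A \<in> carrier_mat n m" "r \<le> n" "r \<le> m"
    and "Determinant.det (Matrix.mat r r (\<lambda>(i, j). A $$ (i, j))) \<noteq> 0"
  shows "r \<le> vec_space.rank n A"
proof -
  have pick: "pick {..<r} i = i" if "i < r" for i
    using pick_reduce_set[of i r UNIV] that by (simp add: pick_UNIV lessThan_def)
  have c: "card {i. i < k \<and> i < r} = r" if "r \<le> k" for k
  proof -
    have "{i. i < k \<and> i < r} = {..<r}" using that by auto
    then show ?thesis by simp
  qed
  have "submatrix A {..<r} {..<r} = Matrix.mat r r (\<lambda>(i, j). A $$ (i, j))"
    using assms(1-3) by (intro eq_matI) (auto simp: submatrix_def c pick)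
  then show ?thesis
    using vec_space.rank_gt_minor[OF assms(1), of "{..<r}" "{..<r}"] assms c by simp
qed

text \<open>The product factors through dimension \<open>2*h\<close>, which bounds the rank above.
  Below, its leading block is the product of two square matrices with nonzero determinants.\<close>

lemma rank_skew_prod:
  fixes B :: "nat \<Rightarrow> nat \<Rightarrow> int"
  assumes hn: "2*h \<le> n"
    and det: "Determinant.det (Matrix.mat (2*h) (2*h) (\<lambda>(i, j). B i j)) \<noteq> 0"
  shows "int_mat_rank (Matrix.mat n n (\<lambda>(i, j). skew_prod h B i j)) = 2*h"
proof (rule antisym)
  let ?A = "map_mat rat_of_int (Matrix.mat n n (\<lambda>(i, j). skew_prod h B i j))"
  have "?A = Matrix.mat n n (\<lambda>(i, j). \<Sum>k<2*h. rat_of_int (B i k) * rat_of_int (skew_dual h B k j))"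
    by (intro eq_matI) (auto simp: skew_prod_eq_sum)
  then have "vec_space.rank n ?A \<le> 2*h"
    using rank_sum_products_le[where r = "2*h" and f = "\<lambda>k i. rat_of_int (B i k)"
        and g = "\<lambda>k j. rat_of_int (skew_dual h B k j)"] by simp
  then show "int_mat_rank (Matrix.mat n n (\<lambda>(i, j). skew_prod h B i j)) \<le> 2*h"
    by (simp add: int_mat_rank_def)
  let ?B = "Matrix.mat (2*h) (2*h) (\<lambda>(i, j). B i j)"
  let ?N = "Matrix.mat (2*h) (2*h) (\<lambda>(i, j). skew_dual h B i j)"
  let ?S = "Matrix.mat (2*h) (2*h) (\<lambda>(i, j). skew_prod h B i j)"
  obtain X where X: "\<And>k l. k < 2*h \<Longrightarrow> l < 2*h \<Longrightarrow>
    (\<Sum>j<2*h. skew_dual h B k j * X j l) = (if k = l then Determinant.det ?B else 0)"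
    using skew_dual_right_inverse[of h B] by blast
  \<comment> \<open>Taking determinants here shows that \<open>det ?N\<close> divides a power of
    \<open>det ?B\<close>, so it is nonzero.\<close>
  have "?N * Matrix.mat (2*h) (2*h) (\<lambda>(i, j). X i j) = Determinant.det ?B \<cdot>\<^sub>m 1\<^sub>m (2*h)"
    by (intro eq_matI) (auto simp: scalar_prod_def X[unfolded lessThan_atLeast0])
  then have "Determinant.det ?N * Determinant.det (Matrix.mat (2*h) (2*h) (\<lambda>(i, j). X i j))
      = Determinant.det ?B ^ (2*h)"
    by (subst det_mult[symmetric, where n = "2*h"]) auto
  then have "Determinant.det ?N \<noteq> 0" using det by auto
  moreover have "?S = ?B * ?N"
    by (intro eq_matI) (auto simp: scalar_prod_def skew_prod_eq_sum lessThan_atLeast0)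
  ultimately have "Determinant.det ?S \<noteq> 0"
    using det by (simp add: det_mult[where n = "2*h"])
  then have "Determinant.det (map_mat rat_of_int ?S) \<noteq> 0" by simp
  moreover have "map_mat rat_of_int ?S = Matrix.mat (2*h) (2*h) (\<lambda>(i, j). ?A $$ (i, j))"
    using hn by (intro eq_matI) auto
  ultimately have "2*h \<le> vec_space.rank n ?A"
    using hn by (intro rank_ge_leading_minor) auto
  then show "2*h \<le> int_mat_rank (Matrix.mat n n (\<lambda>(i, j). skew_prod h B i j))"
    by (simp add: int_mat_rank_def)
qed

lemma skew_prod_mat_alt: "Matrix.mat n n (\<lambda>(i, j). skew_prod h B i j) \<in> alt_int_mats n"
  unfolding alt_int_mats_def
  by (auto intro!: eq_matI simp: skew_prod_def sum_negf[symmetric] algebra_simps intro!: sum.cong)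

section \<open>Norm bounds and finiteness\<close>

lemma int_mat_norm_le:
  assumes "A \<in> carrier_mat n n" "\<And>i j. i < n \<Longrightarrow> j < n \<Longrightarrow> \<bar>A $$ (i, j)\<bar> \<le> b"
  shows "int_mat_norm A \<le> real n * real_of_int b"
proof (cases "n = 0")
  case True
  then show ?thesis using assms(1) by (simp add: int_mat_norm_def)
next
  case False
  then have b: "0 \<le> b" using assms(2)[of 0 0] by linarith
  have "(\<Sum>i<n. \<Sum>j<n. (real_of_int (A $$ (i, j)))\<^sup>2) \<le> (\<Sum>i<n. \<Sum>j<n. (real_of_int b)\<^sup>2)"
    using assms(2) b by (intro sum_mono power2_le_iff_abs_le[THEN iffD2]) (auto simp flip: of_int_abs)
  also have "\<dots> = (real n * real_of_int b)\<^sup>2" by (simp add: power2_eq_square)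
  finally show ?thesis using assms(1) b by (auto simp: int_mat_norm_def intro!: real_le_lsqrt)
qed

lemma entry_le_int_mat_norm:
  assumes "A \<in> carrier_mat n n" "i < n" "j < n"
  shows "\<bar>real_of_int (A $$ (i, j))\<bar> \<le> int_mat_norm A"
proof -
  have "(real_of_int (A $$ (i, j)))\<^sup>2 \<le> (\<Sum>j<n. (real_of_int (A $$ (i, j)))\<^sup>2)"
    using assms by (intro member_le_sum) auto
  also have "\<dots> \<le> (\<Sum>i<n. \<Sum>j<n. (real_of_int (A $$ (i, j)))\<^sup>2)"
    using assms by (intro member_le_sum[where f = "\<lambda>i. \<Sum>j<n. (real_of_int (A $$ (i, j)))\<^sup>2"])
      (auto intro: sum_nonneg)
  finally show ?thesis
    using assms(1) by (auto simp: int_mat_norm_def intro: real_le_rsqrt)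
qed

text \<open>Since \<open>card\<close> is 0 on infinite sets, counting by an injection requires the
  target to be finite.\<close>

lemma finite_int_mat_norm_less: "finite {A \<in> carrier_mat n n. int_mat_norm A < T}"
proof (rule finite_subset)
  let ?P = "({..<n} \<times> {..<n}) \<rightarrow>\<^sub>E {-\<lceil>T\<rceil>..\<lceil>T\<rceil>}"
  show "{A \<in> carrier_mat n n. int_mat_norm A < T} \<subseteq> Matrix.mat n n ` ?P"
  proof
    fix A assume A: "A \<in> {A \<in> carrier_mat n n. int_mat_norm A < T}"
    have "A = Matrix.mat n n (restrict (\<lambda>ij. A $$ ij) ({..<n} \<times> {..<n}))"
      using A by (intro eq_matI) auto
    moreover have "restrict (\<lambda>ij. A $$ ij) ({..<n} \<times> {..<n}) \<in> ?P"
    proof (intro restrict_PiE_iff[THEN iffD2] ballI)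
      fix x assume "x \<in> {..<n} \<times> {..<n}"
      then obtain i j where x: "x = (i, j)" "i < n" "j < n" by auto
      have "\<bar>real_of_int (A $$ (i, j))\<bar> \<le> int_mat_norm A" "int_mat_norm A < T"
        using entry_le_int_mat_norm[of A n i j] A x by auto
      then have "\<bar>real_of_int (A $$ x)\<bar> \<le> T" using x by simp
      then show "A $$ x \<in> {-\<lceil>T\<rceil>..\<lceil>T\<rceil>}" by (auto; linarith)
    qed
    ultimately show "A \<in> Matrix.mat n n ` ?P" by blast
  qed
  show "finite (Matrix.mat n n ` ?P)" by (intro finite_imageI finite_PiE) auto
qed

section \<open>Counting non-primitive matrices\<close>

text \<open>Fix the coordinates outside \<open>T\<close>. The fibre embeds into the product over
  \<open>T\<close> of its coordinate projections, each of size at most \<open>q\<close>.\<close>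

lemma card_determined_le:
  fixes F :: "('a \<Rightarrow> 'b) set"
  assumes F: "F \<subseteq> S \<rightarrow>\<^sub>E A" and fin: "finite S" "finite A" and TS: "T \<subseteq> S"
    and q: "\<And>g t. t \<in> T \<Longrightarrow> card ((\<lambda>f. f t) ` {f \<in> F. restrict f (S - T) = g}) \<le> q"
  shows "card F \<le> card A ^ (card S - card T) * q ^ card T"
proof -
  have finT: "finite T" using TS fin finite_subset by blast
  have finF: "finite F" using F fin by (meson finite_PiE finite_subset)
  define E where "E g = {f \<in> F. restrict f (S - T) = g}" for g
  have cE: "card (E g) \<le> q ^ card T" for g
  proof -
    let ?V = "\<lambda>t. (\<lambda>f. f t) ` E g"
    have fE: "finite (E g)" using finF by (simp add: E_def)
    have "inj_on (\<lambda>f. restrict f T) (E g)"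
    proof (rule inj_onI)
      fix f f' assume f: "f \<in> E g" "f' \<in> E g" and eq: "restrict f T = restrict f' T"
      then have "restrict f (S - T) = restrict f' (S - T)" by (simp add: E_def)
      then have "f x = f' x" if "x \<in> S" for x
        using eq that by (cases "x \<in> T") (auto dest: fun_cong[of _ _ x])
      moreover have "f \<in> S \<rightarrow>\<^sub>E A" "f' \<in> S \<rightarrow>\<^sub>E A" using f F by (auto simp: E_def)
      ultimately show "f = f'" by (intro PiE_ext)
    qed
    moreover have "(\<lambda>f. restrict f T) ` E g \<subseteq> PiE T ?V" by auto
    ultimately have "card (E g) \<le> card (PiE T ?V)"
      using finT fE by (intro card_inj_on_le) (auto intro: finite_PiE)
    also have "\<dots> = (\<Prod>t\<in>T. card (?V t))" using finT by (rule card_PiE)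
    also have "\<dots> \<le> (\<Prod>t\<in>T. q)"
      using q by (intro prod_mono) (auto simp: E_def)
    finally show ?thesis by simp
  qed
  have "F \<subseteq> (\<Union>g\<in>(S - T) \<rightarrow>\<^sub>E A. E g)"
    using F by (auto simp: E_def PiE_iff)
  then have "card F \<le> card (\<Union>g\<in>(S - T) \<rightarrow>\<^sub>E A. E g)"
    using fin finF by (intro card_mono finite_UN_I finite_PiE) (auto simp: E_def)
  also have "\<dots> \<le> (\<Sum>g\<in>(S - T) \<rightarrow>\<^sub>E A. card (E g))"
    using fin by (intro card_UN_le finite_PiE) auto
  also have "\<dots> \<le> (\<Sum>g\<in>(S - T) \<rightarrow>\<^sub>E A. q ^ card T)"
    by (intro sum_mono cE)
  also have "\<dots> = card A ^ (card S - card T) * q ^ card T"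
    using fin TS finT by (simp add: card_PiE card_Diff_subset)
  finally show ?thesis .
qed

text \<open>Scale by an inverse of \<open>u a\<close> modulo \<open>p\<close> and reduce. One
  \<open>v\<close> serves all coefficient rows \<open>c\<close> and lengths \<open>K\<close>, so a
  whole system of congruences carries over.\<close>

lemma normalise_mod_prime:
  fixes p :: int and u :: "nat \<Rightarrow> int"
  assumes "prime p" "\<not> p dvd u a"
  obtains v where "v a = 1" "\<And>k. v k \<in> {0..<p}"
    "\<And>c K. p dvd (\<Sum>k<K. c k * u k) \<Longrightarrow> p dvd (\<Sum>k<K. c k * v k)"
proof -
  have p1: "1 < p" using assms(1) prime_gt_1_int by blast
  have "coprime (u a) p"
    using assms by (metis coprime_commute prime_imp_coprime)
  then obtain x where x: "[u a * x = 1] (mod p)" using cong_solve_coprime_int by blast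
  show ?thesis
  proof
    show "(u a * x) mod p = 1" using x p1 by (simp add: cong_def)
    show "(u k * x) mod p \<in> {0..<p}" for k using p1 by simp
    fix c :: "nat \<Rightarrow> int" and K
    assume "p dvd (\<Sum>k<K. c k * u k)"
    then have "p dvd (\<Sum>k<K. c k * u k) * x" by simp
    moreover have "[(\<Sum>k<K. c k * u k) * x = (\<Sum>k<K. c k * ((u k * x) mod p))] (mod p)"
      unfolding sum_distrib_right mult.assoc
      by (intro cong_sum cong_mult cong_refl) (simp add: cong_def)
    ultimately show "p dvd (\<Sum>k<K. c k * ((u k * x) mod p))"
      using cong_dvd_iff by blast
  qed
qed

text \<open>Elements of \<open>V\<close> share their residue, so they are told apart by their
  quotients, which lie between 0 and \<open>s div nat p\<close>.\<close>

lemma card_cong_le: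
  assumes "V \<subseteq> {0..<int s}" "0 < p" "\<And>x y. x \<in> V \<Longrightarrow> y \<in> V \<Longrightarrow> p dvd x - y"
  shows "card V \<le> s div nat p + 1"
proof -
  have "inj_on (\<lambda>x. x div p) V"
  proof (rule inj_onI)
    fix x y assume "x \<in> V" "y \<in> V" and eq: "x div p = y div p"
    then have "x mod p = y mod p" using assms(3) by (simp add: mod_eq_dvd_iff)
    then show "x = y" using eq by (metis div_mult_mod_eq)
  qed
  moreover have "(\<lambda>x. x div p) ` V \<subseteq> {0..int (s div nat p)}"
  proof (rule image_subsetI)
    fix x assume "x \<in> V"
    then have x: "0 \<le> x" "x \<le> int s" using assms(1) by auto
    have "int (s div nat p) = int s div p" using assms(2) by (simp add: zdiv_int)
    then show "x div p \<in> {0..int (s div nat p)}"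
      using x assms(2) by (simp add: zdiv_mono1 pos_imp_zdiv_nonneg_iff)
  qed
  ultimately have "card V \<le> card {0..int (s div nat p)}" by (intro card_inj_on_le) auto
  then show ?thesis by simp
qed

text \<open>The product of these distinct primes divides \<open>D\<close>; as each exceeds
  \<open>s\<close>, more than \<open>k\<close> of them would make \<open>\<bar>D\<bar>\<close> too
  large.\<close>

lemma card_large_prime_divisors_le:
  fixes D :: int
  assumes "D \<noteq> 0" "\<bar>D\<bar> < int s ^ Suc k"
  shows "finite {p. prime p \<and> int s < p \<and> p dvd D}"
    and "card {p. prime p \<and> int s < p \<and> p dvd D} \<le> k"
proof -
  let ?P = "{p. prime p \<and> int s < p \<and> p dvd D}"
  have "?P \<subseteq> {0..\<bar>D\<bar>}"
  proof
    fix p assume "p \<in> ?P"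
    then show "p \<in> {0..\<bar>D\<bar>}"
      using dvd_imp_le_int[OF assms(1), of p] by (auto simp: prime_ge_0_int)
  qed
  then show fin: "finite ?P" using finite_subset by blast
  have "(\<Prod>p\<in>Q. p) dvd D" if "finite Q" "Q \<subseteq> ?P" for Q
    using that
  proof (induction Q rule: finite_induct)
    case (insert x Q)
    have "coprime x (\<Prod>p\<in>Q. p)"
      using insert by (intro prod_coprime_right primes_coprime) auto
    then show ?case using insert by (simp add: divides_mult)
  qed simp
  then have "(\<Prod>p\<in>?P. p) dvd D" using fin by blast
  then have "(\<Prod>p\<in>?P. p) \<le> \<bar>D\<bar>"
    using dvd_imp_le_int[OF assms(1)] abs_ge_self order_trans by blast
  moreover have "(\<Prod>p\<in>?P. int s) \<le> (\<Prod>p\<in>?P. p)"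
    by (intro prod_mono) auto
  ultimately have "int s ^ card ?P < int s ^ Suc k" using assms(2) by simp
  moreover have "0 < s" using assms(2) by (cases s) auto
  ultimately have "\<not> Suc k \<le> card ?P"
    using power_increasing[of "Suc k" "card ?P" "int s"] by linarith
  then show "card ?P \<le> k" by simp
qed

section \<open>The box of matrices\<close>

definition entry_box :: "nat \<Rightarrow> nat \<Rightarrow> nat \<Rightarrow> (nat \<times> nat \<Rightarrow> int) set" where
  "entry_box n r s = ({..<n} \<times> {..<r}) \<rightarrow>\<^sub>E {0..<int s}"

text \<open>The matrix \<open>B\<close> with free parameters \<open>y\<close>. For
  \<open>M dvd L\<close> it is the identity on top of zero modulo \<open>M\<close>, and a large
  \<open>L\<close> makes its upper block diagonally dominant.\<close>

definition shifted :: "int \<Rightarrow> int \<Rightarrow> (nat \<times> nat \<Rightarrow> int) \<Rightarrow> nat \<Rightarrow> nat \<Rightarrow> int" where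
  "shifted M L y i j = M * y (i, j) + (if i = j then L + 1 else 0)"

lemma finite_entry_box: "finite (entry_box n r s)"
  unfolding entry_box_def by (intro finite_PiE) auto

lemma card_entry_box: "card (entry_box n r s) = s ^ (n * r)"
  unfolding entry_box_def by (subst card_PiE) (auto simp: card_cartesian_product)

lemma entry_box_range:
  assumes "y \<in> entry_box n r s" "i < n" "j < r"
  shows "y (i, j) \<in> {0..<int s}"
  using PiE_mem[OF assms(1)[unfolded entry_box_def], of "(i, j)"] assms(2,3) by simp

section \<open>Primes up to the side of the box\<close>

lemma not_inj_mod_prime:
  assumes "\<not> inj_mod p m k B" "prime p"
  obtains a v where "a < k" "v a = 1" "\<And>j. v j \<in> {0..<p}"
    "\<And>i. i < m \<Longrightarrow> p dvd (\<Sum>j<k. B i j * v j)"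
proof -
  obtain u a where u: "\<And>i. i < m \<Longrightarrow> p dvd (\<Sum>j<k. B i j * u j)" "a < k" "\<not> p dvd u a"
    using assms(1) unfolding inj_mod_def by blast
  obtain v where "v a = 1" "\<And>j. v j \<in> {0..<p}"
    "\<And>c K. p dvd (\<Sum>k<K. c k * u k) \<Longrightarrow> p dvd (\<Sum>k<K. c k * v k)"
    using normalise_mod_prime[of p u a] assms(2) u(3) by metis
  then show ?thesis using u that by blast
qed

text \<open>As \<open>v a = 1\<close> and \<open>M\<close> is invertible modulo \<open>p\<close>,
  the congruence of each row fixes its entry in column \<open>a\<close> modulo \<open>p\<close> in
  terms of the other entries.\<close>

lemma card_kernel_le:
  assumes p: "prime p" "\<not> p dvd M" and a: "a < r" "v a = 1"
  shows "card {y \<in> entry_box n r s. \<forall>i<n. p dvd (\<Sum>j<r. shifted M L y i j * v j)}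
    \<le> s ^ (n * r - n) * (s div nat p + 1) ^ n" (is "card ?F \<le> _")
proof -
  let ?S = "{..<n} \<times> {..<r}" and ?T = "{..<n} \<times> {a}"
  have "card ?F \<le> card {0..<int s} ^ (card ?S - card ?T) * (s div nat p + 1) ^ card ?T"
  proof (rule card_determined_le)
    show "?F \<subseteq> ?S \<rightarrow>\<^sub>E {0..<int s}" by (auto simp: entry_box_def)
    show "?T \<subseteq> ?S" using a by auto
    fix g t assume "t \<in> ?T"
    then obtain i where t: "t = (i, a)" "i < n" by auto
    show "card ((\<lambda>f. f t) ` {f \<in> ?F. restrict f (?S - ?T) = g}) \<le> s div nat p + 1"
    proof (rule card_cong_le)
      show "(\<lambda>f. f t) ` {f \<in> ?F. restrict f (?S - ?T) = g} \<subseteq> {0..<int s}"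
      proof (rule image_subsetI)
        fix f assume "f \<in> {f \<in> ?F. restrict f (?S - ?T) = g}"
        then show "f t \<in> {0..<int s}" unfolding t using entry_box_range[of f n r s i a] t a by blast
      qed
      show "0 < p" using p prime_gt_0_int by blast
      fix x x'
      assume "x \<in> (\<lambda>f. f t) ` {f \<in> ?F. restrict f (?S - ?T) = g}"
        "x' \<in> (\<lambda>f. f t) ` {f \<in> ?F. restrict f (?S - ?T) = g}"
      then obtain f f' where f: "x = f t" "f \<in> ?F" "x' = f' t" "f' \<in> ?F"
        and eq: "restrict f (?S - ?T) = restrict f' (?S - ?T)" by auto
      have ff: "f (i, j) = f' (i, j)" if "j < r" "j \<noteq> a" for j
        using fun_cong[OF eq, of "(i, j)"] that t by simp
      have "p dvd (\<Sum>j<r. shifted M L f i j * v j) - (\<Sum>j<r. shifted M L f' i j * v j)"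
        using f t by (intro dvd_diff) auto
      also have "(\<Sum>j<r. shifted M L f i j * v j) - (\<Sum>j<r. shifted M L f' i j * v j) =
        (\<Sum>j<r. if j = a then M * (x - x') else 0)"
        unfolding sum_subtractf[symmetric] shifted_def using ff a f t
        by (intro sum.cong) (auto simp: algebra_simps)
      also have "\<dots> = M * (x - x')" using a by simp
      finally show "p dvd x - x'" using p prime_dvd_mult_iff by blast
    qed
  qed auto
  moreover have "card {0..<int s} = s" "card ?S = n * r" "card ?T = n"
    by (simp_all add: card_cartesian_product)
  ultimately show ?thesis by (simp only:)
qed

lemma card_normalised_le:
  fixes p :: int
  assumes "a < r"
  shows "card {v \<in> {..<r} \<rightarrow>\<^sub>E {0..<p}. v a = 1} \<le> nat p ^ (r - 1)"
proof -
  have "card {v \<in> {..<r} \<rightarrow>\<^sub>E {0..<p}. v a = 1} \<le>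
    card {0..<p} ^ (card {..<r} - card {a}) * 1 ^ card {a}"
  proof (rule card_determined_le)
    fix g t assume "t \<in> {a}"
    then have "(\<lambda>f. f t) ` {f \<in> {v \<in> {..<r} \<rightarrow>\<^sub>E {0..<p}. v a = 1}. restrict f ({..<r} - {a}) = g} \<subseteq> {1}"
      by auto
    from card_mono[OF _ this]
    show "card ((\<lambda>f. f t) ` {f \<in> {v \<in> {..<r} \<rightarrow>\<^sub>E {0..<p}. v a = 1}. restrict f ({..<r} - {a}) = g}) \<le> 1"
      by simp
  qed (use assms in auto)
  then show ?thesis by simp
qed

text \<open>There are at most \<open>r * p ^ (r - 1)\<close> normalised kernel vectors, each killing
  a proportion of at most \<open>(2 / p) ^ n\<close> of the box. The exponent
  \<open>r - 1 - n\<close> of \<open>p\<close> is at most -2 because \<open>r < n\<close>.\<close>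

lemma card_not_inj_mod_small_prime_le:
  assumes p: "prime p" "\<not> p dvd M" "p \<le> int s" and rn: "r < n"
  shows "real (card {y \<in> entry_box n r s. \<not> inj_mod p n r (shifted M L y)})
    \<le> real r * 2 ^ n * real s ^ (n * r) / (real_of_int p)\<^sup>2" (is "real (card ?Bad) \<le> _")
proof -
  have p0: "0 < p" using p(1) by (rule prime_gt_0_int)
  define U where "U a = {v \<in> {..<r} \<rightarrow>\<^sub>E {0..<p}. v a = 1}" for a
  define K where "K v = {y \<in> entry_box n r s. \<forall>i<n. p dvd (\<Sum>j<r. shifted M L y i j * v j)}" for v
  have finU: "finite (U a)" for a unfolding U_def by (intro finite_Collect_conjI disjI1) (simp add: finite_PiE)
  have finK: "finite (K v)" for v unfolding K_def using finite_entry_box by simp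
  let ?q = "s ^ (n * r - n) * (s div nat p + 1) ^ n"
  have "?Bad \<subseteq> (\<Union>a<r. \<Union>v\<in>U a. K v)"
  proof
    fix y assume y: "y \<in> ?Bad"
    then obtain a v where v: "a < r" "v a = 1" "\<And>j. v j \<in> {0..<p}"
      "\<And>i. i < n \<Longrightarrow> p dvd (\<Sum>j<r. shifted M L y i j * v j)"
      using not_inj_mod_prime p(1) by blast
    have "restrict v {..<r} \<in> U a" using v by (auto simp: U_def)
    moreover have "y \<in> K (restrict v {..<r})" using v y by (auto simp: K_def)
    ultimately show "y \<in> (\<Union>a<r. \<Union>v\<in>U a. K v)" using v(1) by blast
  qed
  then have "card ?Bad \<le> card (\<Union>a<r. \<Union>v\<in>U a. K v)"
    using finU finK by (intro card_mono) auto
  also have "\<dots> \<le> (\<Sum>a<r. card (\<Union>v\<in>U a. K v))" by (rule card_UN_le) simp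
  also have "\<dots> \<le> (\<Sum>a<r. nat p ^ (r - 1) * ?q)"
  proof (rule sum_mono)
    fix a assume a: "a \<in> {..<r}"
    have "card (\<Union>v\<in>U a. K v) \<le> (\<Sum>v\<in>U a. card (K v))" using finU by (rule card_UN_le)
    also have "\<dots> \<le> (\<Sum>v\<in>U a. ?q)"
      using card_kernel_le[OF p(1,2)] a by (intro sum_mono) (auto simp: K_def U_def)
    also have "\<dots> = card (U a) * ?q" by simp
    also have "\<dots> \<le> nat p ^ (r - 1) * ?q"
      using card_normalised_le[of a r p] a by (intro mult_right_mono) (auto simp: U_def)
    finally show "card (\<Union>v\<in>U a. K v) \<le> nat p ^ (r - 1) * ?q" .
  qed
  finally have "card ?Bad \<le> r * (nat p ^ (r - 1) * ?q)" by simp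
  then have "real (card ?Bad) \<le> real (r * (nat p ^ (r - 1) * ?q))"
    by (rule of_nat_mono)
  also have "\<dots> = real r * (real_of_int p ^ (r - 1) * (real s ^ (n * r - n) * (real (s div nat p) + 1) ^ n))"
    using p0 by (simp add: add.commute)
  also have "\<dots> \<le> real r * (real_of_int p ^ (r - 1) * (real s ^ (n * r - n) * (2 * real s / real_of_int p) ^ n))"
  proof -
    have "real (s div nat p) \<le> real s / real_of_int p"
      using of_nat_div_le_of_nat[of s "nat p", where 'a = real] p0 by simp
    moreover have "1 \<le> real s / real_of_int p" using p(3) p0 by simp
    moreover have "2 * real s / real_of_int p = real s / real_of_int p + real s / real_of_int p"
      by simp
    \<comment> \<open>The hypothesis \<open>p \<le> int s\<close> lets \<open>s / p\<close> absorb
      the rounding term 1.\<close>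
    ultimately have "real (s div nat p) + 1 \<le> 2 * real s / real_of_int p" by linarith
    then show ?thesis
      using p0 by (intro mult_left_mono power_mono) auto
  qed
  also have "\<dots> \<le> real r * 2 ^ n * real s ^ (n * r) / (real_of_int p)\<^sup>2"
  \<comment> \<open>For \<open>r = 0\<close> both sides vanish; otherwise the truncated differences
    \<open>r - 1\<close> and \<open>n * r - n\<close> are genuine.\<close>
  proof (cases "r = 0")
    case False
    have p1: "1 \<le> real_of_int p" using p0 by linarith
    have s: "real s ^ (n * r) = real s ^ (n * r - n) * real s ^ n"
      using False by (simp flip: power_add)
    have "real_of_int p ^ (r - 1) * (real_of_int p)\<^sup>2 = real_of_int p ^ (r - 1 + 2)"
      by (rule power_add[symmetric])
    also have "\<dots> \<le> real_of_int p ^ n" using rn p1 False by (intro power_increasing) auto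
    finally have "real_of_int p ^ (r - 1) / real_of_int p ^ n \<le> 1 / (real_of_int p)\<^sup>2"
      using p1 by (simp add: field_simps)
    then have "real r * 2 ^ n * real s ^ (n * r) * (real_of_int p ^ (r - 1) / real_of_int p ^ n)
      \<le> real r * 2 ^ n * real s ^ (n * r) * (1 / (real_of_int p)\<^sup>2)"
      by (intro mult_left_mono) auto
    then show ?thesis unfolding s by (simp add: power_mult_distrib power_divide algebra_simps)
  qed simp
  finally show ?thesis .
qed

section \<open>Primes beyond the side of the box\<close>

lemma shifted_cong_id:
  assumes "M dvd L"
  shows "[shifted M L y i j = (if i = j then 1 else 0)] (mod M)"
proof -
  have "[M * y (i, j) + L = 0] (mod M)" "[M * y (i, j) = 0] (mod M)"
    using assms by (simp_all add: cong_0_iff)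
  from cong_add[OF this(1) cong_refl[of 1 M]] this(2) show ?thesis
    by (auto simp: shifted_def add.assoc)
qed

text \<open>All leading minors are 1 modulo \<open>M\<close>, hence nonzero.\<close>

lemma det_shifted_nonzero:
  assumes "M dvd L" "1 < M"
  shows "Determinant.det (Matrix.mat k k (\<lambda>(i, j). shifted M L y i j)) \<noteq> 0"
proof
  assume 0: "Determinant.det (Matrix.mat k k (\<lambda>(i, j). shifted M L y i j)) = 0"
  have "[Determinant.det (Matrix.mat k k (\<lambda>(i, j). shifted M L y i j)) = Determinant.det (1\<^sub>m k)] (mod M)"
    by (rule det_cong[of _ k]) (use shifted_cong_id[OF assms(1)] in auto)
  then show False using 0 assms(2) by (simp add: cong_def)
qed

text \<open>If the last coordinate of a kernel vector vanished modulo \<open>p\<close>, the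
  remaining ones would form a kernel vector of the smaller block, which is injective. So the last
  coordinate can be normalised to 1.\<close>

lemma kernel_at_first_failure:
  assumes p: "prime p" and inj: "inj_mod p (Suc a) a B"
    and ninj: "\<not> inj_mod p (Suc (Suc a)) (Suc a) B"
  obtains v where "v a = 1"
    "\<And>i. i < Suc (Suc a) \<Longrightarrow> p dvd (\<Sum>j<Suc a. B i j * v j)"
proof -
  obtain u k where u: "\<And>i. i < Suc (Suc a) \<Longrightarrow> p dvd (\<Sum>j<Suc a. B i j * u j)"
    "k < Suc a" "\<not> p dvd u k"
    using ninj unfolding inj_mod_def by blast
  have "\<not> p dvd u a"
  proof
    assume ua: "p dvd u a"
    have "p dvd (\<Sum>j<a. B i j * u j)" if "i < Suc a" for i
      using u(1)[of i] that ua by (simp add: dvd_add_left_iff)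
    then have "p dvd u j" if "j < a" for j using inj_modD[OF inj _ that] by blast
    then show False using u(2,3) ua by (metis less_Suc_eq)
  qed
  then obtain v where "v a = 1"
    "\<And>c K. p dvd (\<Sum>k<K. c k * u k) \<Longrightarrow> p dvd (\<Sum>k<K. c k * v k)"
    using normalise_mod_prime[of p u a] p by metis
  then show ?thesis using u(1) that by blast
qed

text \<open>With all entries but \<open>(Suc a, a)\<close> fixed, \<open>p\<close> divides a fixed
  nonzero minor, which leaves at most \<open>Suc a\<close> primes. Each prime allows one value of
  the free entry, so there are at most \<open>r\<close> values.\<close>

lemma card_first_failure_le:
  assumes M: "M dvd L" "1 < M" "M \<le> int s"
    and a: "Suc a < n" "a < r" "r < n"
    and b: "\<And>y i j. y \<in> entry_box n r s \<Longrightarrow> i < n \<Longrightarrow> j < r \<Longrightarrow> \<bar>shifted M L y i j\<bar> \<le> c * int s"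
    and s: "fact (Suc a) * c ^ Suc a < int s"
  shows "card {y \<in> entry_box n r s. \<exists>p. prime p \<and> int s < p \<and> inj_mod p (Suc a) a (shifted M L y) \<and>
      \<not> inj_mod p (Suc (Suc a)) (Suc a) (shifted M L y)} \<le> s ^ (n * r - 1) * r"
    (is "card ?F \<le> _")
proof -
  let ?S = "{..<n} \<times> {..<r}" and ?t = "(Suc a, a)"
  have "card ?F \<le> card {0..<int s} ^ (card ?S - card {?t}) * r ^ card {?t}"
  proof (rule card_determined_le)
    show "?F \<subseteq> ?S \<rightarrow>\<^sub>E {0..<int s}" by (auto simp: entry_box_def)
    show "{?t} \<subseteq> ?S" using a by auto
    fix g t assume "t \<in> {?t}"
    then have t: "t = ?t" by simp
    define E where "E = {f \<in> ?F. restrict f (?S - {?t}) = g}"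
    have Ebox: "f \<in> entry_box n r s" and Eg: "restrict f (?S - {?t}) = g"
      and Ep: "\<exists>p. prime p \<and> int s < p \<and> inj_mod p (Suc a) a (shifted M L f) \<and>
        \<not> inj_mod p (Suc (Suc a)) (Suc a) (shifted M L f)" if "f \<in> E" for f
      using that unfolding E_def by blast+
    let ?V = "(\<lambda>f. f ?t) ` E"
    \<comment> \<open>Only rows up to \<open>a\<close> enter, so the free entry is avoided and
      \<open>g\<close> determines the minor for the whole fibre.\<close>
    define D where "D = Determinant.det (Matrix.mat (Suc a) (Suc a) (\<lambda>(i, j). shifted M L g i j))"
    define P where "P = {p. prime p \<and> int s < p \<and> p dvd D}"
    have D0: "D \<noteq> 0" unfolding D_def by (rule det_shifted_nonzero[OF M(1,2)])
    have same: "f (i, j) = g (i, j)" if "f \<in> E" "i < n" "j < r" "(i, j) \<noteq> ?t" for f i j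
    proof -
      have "g (i, j) = restrict f (?S - {?t}) (i, j)" using Eg[OF that(1)] by simp
      then show ?thesis using that(2-4) by simp
    qed
    have Df: "D = Determinant.det (Matrix.mat (Suc a) (Suc a) (\<lambda>(i, j). shifted M L f i j))"
      if "f \<in> E" for f
      unfolding D_def
      by (intro arg_cong[of _ _ Determinant.det] cong_mat) (use same[OF that] a in \<open>auto simp: shifted_def\<close>)
    show "card ((\<lambda>f. f t) ` {f \<in> ?F. restrict f (?S - {?t}) = g}) \<le> r"
      unfolding t E_def[symmetric]
    proof (cases "E = {}")
      case False
      then obtain f where f: "f \<in> E" by blast
      have "\<bar>D\<bar> \<le> fact (Suc a) * (c * int s) ^ Suc a"
        unfolding Df[OF f] by (rule abs_det_le) (use b[OF Ebox[OF f]] a in auto)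
      also have "\<dots> = (fact (Suc a) * c ^ Suc a) * int s ^ Suc a"
        by (simp add: power_mult_distrib)
      also have "\<dots> < int s * int s ^ Suc a"
        using s M by (intro mult_strict_right_mono) auto
      finally have "\<bar>D\<bar> < int s ^ Suc (Suc a)" by simp
      note P = card_large_prime_divisors_le[OF D0 this, folded P_def]
      define W where "W p = {f ?t | f. f \<in> E \<and> prime p \<and> int s < p \<and>
        inj_mod p (Suc a) a (shifted M L f) \<and>
        \<not> inj_mod p (Suc (Suc a)) (Suc a) (shifted M L f)}" for p
      have "?V \<subseteq> (\<Union>p\<in>P. W p)"
      proof
        fix x assume "x \<in> ?V"
        then obtain f where f: "f \<in> E" "x = f ?t" by blast
        then obtain p where p: "prime p" "int s < p" "inj_mod p (Suc a) a (shifted M L f)"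
          "\<not> inj_mod p (Suc (Suc a)) (Suc a) (shifted M L f)" using Ep by blast
        obtain v where v: "v a = 1"
          "\<And>i. i < Suc (Suc a) \<Longrightarrow> p dvd (\<Sum>j<Suc a. shifted M L f i j * v j)"
          using kernel_at_first_failure[OF p(1,3,4)] by blast
        have "p dvd D" unfolding Df[OF f(1)] by (rule dvd_det_if_kernel[of _ _ _ v a]) (use v in auto)
        then have "p \<in> P" using p by (simp add: P_def)
        moreover have "x \<in> W p" using f p by (auto simp: W_def)
        ultimately show "x \<in> (\<Union>p\<in>P. W p)" by blast
      qed
      have W1: "x = x'" if "x \<in> W p" "x' \<in> W p" for p x x'
      proof -
        from that obtain f f' where f: "f \<in> E" "x = f ?t" "inj_mod p (Suc a) a (shifted M L f)"
          "\<not> inj_mod p (Suc (Suc a)) (Suc a) (shifted M L f)"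
          and f': "f' \<in> E" "x' = f' ?t" "inj_mod p (Suc a) a (shifted M L f')"
          "\<not> inj_mod p (Suc (Suc a)) (Suc a) (shifted M L f')"
          and p: "prime p" "int s < p" unfolding W_def by blast
        obtain v where v: "v a = 1"
          "\<And>i. i < Suc (Suc a) \<Longrightarrow> p dvd (\<Sum>j<Suc a. shifted M L f i j * v j)"
          using kernel_at_first_failure[OF p(1) f(3,4)] by blast
        obtain v' where v': "v' a = 1"
          "\<And>i. i < Suc (Suc a) \<Longrightarrow> p dvd (\<Sum>j<Suc a. shifted M L f' i j * v' j)"
          using kernel_at_first_failure[OF p(1) f'(3,4)] by blast
        have ff: "shifted M L f' i j = shifted M L f i j" if "i < n" "j < r" "(i, j) \<noteq> ?t" for i j
          using same[OF f(1) that] same[OF f'(1) that] by (simp add: shifted_def)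
        \<comment> \<open>Both vectors end in 1, so their difference lies in the kernel of the
          injective block with \<open>Suc a\<close> rows and \<open>a\<close> columns, which
          \<open>f\<close> and \<open>f'\<close> share.\<close>
        have vv: "p dvd v j - v' j" if "j < a" for j
        proof (rule inj_modD[OF f(3) _ that])
          fix i assume i: "i < Suc a"
          have "p dvd (\<Sum>j<Suc a. shifted M L f i j * v j) - (\<Sum>j<Suc a. shifted M L f' i j * v' j)"
            using i v(2)[of i] v'(2)[of i] by (intro dvd_diff) auto
          also have "\<dots> = (\<Sum>j<a. shifted M L f i j * (v j - v' j))"
            using v(1) v'(1) ff[of i] i a by (simp add: sum_subtractf right_diff_distrib)
          finally show "p dvd (\<Sum>j<a. shifted M L f i j * (v j - v' j))" .
        qed
        have "p dvd (\<Sum>j<a. shifted M L f (Suc a) j * (v j - v' j))"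
          using vv by (intro dvd_sum dvd_mult) auto
        \<comment> \<open>Comparing the last rows now leaves only the contribution of the free
          entry.\<close>
        then have "p dvd (\<Sum>j<Suc a. shifted M L f (Suc a) j * v j)
            - (\<Sum>j<Suc a. shifted M L f' (Suc a) j * v' j)
            - (\<Sum>j<a. shifted M L f (Suc a) j * (v j - v' j))"
          using v(2)[OF lessI] v'(2)[OF lessI] by (intro dvd_diff)
        also have "\<dots> = M * (x - x')"
          using v(1) v'(1) ff[of "Suc a"] a f(2) f'(2)
          by (simp add: sum_subtractf right_diff_distrib) (simp add: shifted_def)
        finally have "p dvd M * (x - x')" .
        moreover have "\<not> p dvd M" using M p zdvd_imp_le[of p M] by linarith
        ultimately have "p dvd x - x'" using p(1) prime_dvd_mult_iff by blast
        \<comment> \<open>Two elements of an interval of length \<open>s < p\<close> that agree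
          modulo \<open>p\<close> are equal.\<close>
        moreover have "x \<in> {0..<int s}" "x' \<in> {0..<int s}"
          unfolding f(2) f'(2) 
          by (rule entry_box_range[OF Ebox[OF f(1)] a(1,2)] entry_box_range[OF Ebox[OF f'(1)] a(1,2)])+
        ultimately show "x = x'"
          using p(2) dvd_imp_le_int[of "x - x'" p] by (cases "x = x'") auto
      qed
      have W: "finite (W p)" "card (W p) \<le> 1" for p
      proof -
        have "W p \<subseteq> {SOME x. x \<in> W p}"
        proof
          fix x assume x: "x \<in> W p"
          then have "(SOME x. x \<in> W p) \<in> W p" by (rule someI)
          then show "x \<in> {SOME x. x \<in> W p}" using W1[OF x] by simp
        qed
        from finite_subset[OF this] card_mono[OF _ this]
        show "finite (W p)" "card (W p) \<le> 1" by simp_all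
      qed
      then have "(\<Sum>p\<in>P. card (W p)) \<le> (\<Sum>p\<in>P. 1)" by (intro sum_mono) auto
      moreover have "card ?V \<le> card (\<Union>p\<in>P. W p)"
        using \<open>?V \<subseteq> (\<Union>p\<in>P. W p)\<close> P(1) W(1) by (intro card_mono) auto
      ultimately have "card ?V \<le> (\<Sum>p\<in>P. 1)"
        using card_UN_le[OF P(1), of W] by linarith
      then show "card ?V \<le> r" using P(2) a by simp
    qed simp
  qed auto
  moreover have "card {0..<int s} = s" "card ?S = n * r" "card {?t} = 1"
    by (simp_all add: card_cartesian_product)
  ultimately show ?thesis by (simp only: power_one_right)
qed

section \<open>A positive proportion of the box is primitive\<close>

text \<open>Telescoping: the term at \<open>b + 1\<close> is at most
  \<open>1 / b - 1 / (b + 1)\<close>.\<close>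

lemma sum_inverse_squares_le:
  assumes "0 < a" "a \<le> b"
  shows "(\<Sum>m\<in>{a<..b}. 1 / (real m)\<^sup>2) \<le> 1 / real a - 1 / real b"
  using assms(2)
proof (induction b rule: dec_induct)
  case (step b)
  have b: "0 < real b" using step assms by simp
  have "{a<..Suc b} = insert (Suc b) {a<..b}" using step by auto
  then have "(\<Sum>m\<in>{a<..Suc b}. 1 / (real m)\<^sup>2) \<le> 1 / (real (Suc b))\<^sup>2 + (1 / real a - 1 / real b)"
    using step by simp
  also have "1 / (real (Suc b))\<^sup>2 \<le> 1 / (real b * real (Suc b))"
    using b unfolding power2_eq_square by (intro divide_left_mono mult_right_mono) auto
  also have "\<dots> = 1 / real b - 1 / real (Suc b)"
    using b by (simp add: field_simps)
  finally show ?case by simp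
qed simp

text \<open>Modulo \<open>d\<close> the first \<open>r\<close> rows form the identity, so row
  \<open>j\<close> of the system reads off \<open>u j\<close>.\<close>

lemma inj_mod_shifted_dvd:
  assumes "d dvd M" "M dvd L" "r \<le> n"
  shows "inj_mod d n r (shifted M L y)"
  unfolding inj_mod_def
proof (intro allI impI)
  fix u j assume u: "\<forall>i<n. d dvd (\<Sum>j<r. shifted M L y i j * u j)" and j: "j < r"
  have "[(\<Sum>k<r. shifted M L y j k * u k) = (\<Sum>k<r. (if j = k then 1 else 0) * u k)] (mod d)"
    by (intro cong_sum cong_mult cong_refl cong_dvd_modulus[OF shifted_cong_id assms(1)] assms(2))
  also have "(\<Sum>k<r. (if j = k then 1 else 0) * u k) = (\<Sum>k<r. if j = k then u k else 0)"
    by (intro sum.cong) auto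
  also have "\<dots> = u j" using j by simp
  finally show "d dvd u j" using u j assms(3) cong_dvd_iff by (meson order_less_le_trans)
qed

text \<open>Injectivity holds trivially with no columns and fails at \<open>r\<close> columns with
  only \<open>Suc r \<le> n\<close> rows kept, so there is a first failure.\<close>

lemma first_failure_exists:
  assumes "\<not> inj_mod p n r B" "r < n"
  obtains a where "a < r" "inj_mod p (Suc a) a B" "\<not> inj_mod p (Suc (Suc a)) (Suc a) B"
proof -
  have "\<not> inj_mod p (Suc r) r B" using assms inj_mod_mono Suc_leI by blast
  moreover have "inj_mod p (Suc 0) 0 B" by (simp add: inj_mod_def)
  ultimately obtain k where "k < r" "\<not> inj_mod p (Suc (Suc k)) (Suc k) B"
      "\<forall>i\<le>k. inj_mod p (Suc i) i B"
    using ex_least_nat_less[of "\<lambda>k. \<not> inj_mod p (Suc k) k B" r] by auto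
  then show ?thesis using that by blast
qed

definition primitive_box :: "nat \<Rightarrow> nat \<Rightarrow> nat \<Rightarrow> int \<Rightarrow> int \<Rightarrow> (nat \<times> nat \<Rightarrow> int) set" where
  "primitive_box n r s M L =
     {y \<in> entry_box n r s. \<forall>p. prime p \<longrightarrow> inj_mod p n r (shifted M L y)}"

text \<open>Primes up to \<open>Q\<close> divide \<open>M\<close> and exclude nothing. Those in
  \<open>(Q, s]\<close> and those above \<open>s\<close> each exclude at most a quarter of the
  box.\<close>

lemma card_primitive_box_ge:
  fixes Q n r s :: nat and L c :: int
  defines "M \<equiv> fact Q"
  assumes Q: "n * 2 ^ (n + 2) \<le> Q" "2 \<le> Q" and L: "M dvd L" and rn: "r < n"
    and b: "\<And>y i j. y \<in> entry_box n r s \<Longrightarrow> i < n \<Longrightarrow> j < r \<Longrightarrow> \<bar>shifted M L y i j\<bar> \<le> c * int s"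
    and c: "1 \<le> c" and s: "fact n * c ^ n < int s" "M \<le> int s" "Q \<le> s" "4 * n\<^sup>2 \<le> s"
  shows "real s ^ (n * r) / 2 \<le> real (card (primitive_box n r s M L))"
proof -
  let ?N = "real s ^ (n * r)"
  have "int Q \<le> int (fact Q)" using fact_ge_self[of Q] by (rule of_nat_mono)
  then have M1: "1 < M" using Q(2) unfolding M_def of_nat_fact by linarith
  have s0: "0 < s" using Q s by simp
  define Small where "Small m = {y \<in> entry_box n r s. \<not> inj_mod (int m) n r (shifted M L y)}" for m
  define Large where "Large a = {y \<in> entry_box n r s. \<exists>p. prime p \<and> int s < p \<and>
    inj_mod p (Suc a) a (shifted M L y) \<and> \<not> inj_mod p (Suc (Suc a)) (Suc a) (shifted M L y)}" for a
  let ?I = "{m \<in> {Q<..s}. prime m}"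
  have fin: "finite (Small m)" "finite (Large a)" for m a
    using finite_entry_box by (simp_all add: Small_def Large_def)
  have "entry_box n r s - primitive_box n r s M L \<subseteq> (\<Union>m\<in>?I. Small m) \<union> (\<Union>a<r. Large a)"
  proof
    fix y assume y: "y \<in> entry_box n r s - primitive_box n r s M L"
    then obtain p where p: "prime p" "\<not> inj_mod p n r (shifted M L y)"
      unfolding primitive_box_def by blast
    have p0: "0 < p" using p(1) by (rule prime_gt_0_int)
    consider "p \<le> int Q" | "int Q < p" "p \<le> int s" | "int s < p" by linarith
    then show "y \<in> (\<Union>m\<in>?I. Small m) \<union> (\<Union>a<r. Large a)"
    proof cases
      case 1
      then have "int (nat p) dvd int (fact Q)"
        unfolding int_dvd_int_iff using p0 by (intro dvd_fact) auto
      then have "p dvd M" using p0 by (simp add: M_def)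
      then show ?thesis using inj_mod_shifted_dvd[OF _ L] p(2) rn by force
    next
      case 2
      then have "nat p \<in> ?I" using p(1) p0 by auto
      moreover have "y \<in> Small (nat p)" using y p p0 by (simp add: Small_def)
      ultimately show ?thesis by blast
    next
      case 3
      obtain a where "a < r" "inj_mod p (Suc a) a (shifted M L y)"
        "\<not> inj_mod p (Suc (Suc a)) (Suc a) (shifted M L y)"
        using first_failure_exists[OF p(2) rn] .
      then have "y \<in> Large a" "a < r" using y p 3 by (auto simp: Large_def)
      then show ?thesis by blast
    qed
  qed
  then have "card (entry_box n r s - primitive_box n r s M L)
      \<le> card ((\<Union>m\<in>?I. Small m) \<union> (\<Union>a<r. Large a))"
    using fin by (intro card_mono) auto
  also have "\<dots> \<le> card (\<Union>m\<in>?I. Small m) + card (\<Union>a<r. Large a)" by (rule card_Un_le)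
  also have "\<dots> \<le> (\<Sum>m\<in>?I. card (Small m)) + (\<Sum>a<r. card (Large a))"
    by (intro add_mono card_UN_le) auto
  finally have bad: "real (card (entry_box n r s - primitive_box n r s M L))
      \<le> (\<Sum>m\<in>?I. real (card (Small m))) + (\<Sum>a<r. real (card (Large a)))"
    by (simp flip: of_nat_sum of_nat_add)
  have "(\<Sum>m\<in>?I. real (card (Small m))) \<le> (\<Sum>m\<in>?I. real r * 2 ^ n * ?N * (1 / (real m)\<^sup>2))"
  proof (rule sum_mono)
    fix m assume m: "m \<in> ?I"
    have "prime m" "\<not> m \<le> Q" using m by auto
    then have "\<not> m dvd fact Q" using prime_dvd_fact_iff by blast
    then have "\<not> int m dvd int (fact Q)" unfolding int_dvd_int_iff .
    then have "\<not> int m dvd M" unfolding M_def of_nat_fact .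
    then show "real (card (Small m)) \<le> real r * 2 ^ n * ?N * (1 / (real m)\<^sup>2)"
      using card_not_inj_mod_small_prime_le[of "int m" M s r n L] m rn by (simp add: Small_def)
  qed
  \<comment> \<open>Extending the sum from primes to all integers still leaves a tail of at most
    \<open>1 / Q\<close>.\<close>
  also have "\<dots> \<le> (\<Sum>m\<in>{Q<..s}. real r * 2 ^ n * ?N * (1 / (real m)\<^sup>2))"
    by (intro sum_mono2) auto
  also have "\<dots> = real r * 2 ^ n * ?N * (\<Sum>m\<in>{Q<..s}. 1 / (real m)\<^sup>2)"
    by (rule sum_distrib_left[symmetric])
  also have "\<dots> \<le> real r * 2 ^ n * ?N * (1 / real Q)"
  proof (rule mult_left_mono)
    have "0 \<le> 1 / real s" by simp
    then show "(\<Sum>m\<in>{Q<..s}. 1 / (real m)\<^sup>2) \<le> 1 / real Q"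
      using sum_inverse_squares_le[of Q s] Q s by linarith
  qed simp
  also have "\<dots> \<le> ?N / 4"
  proof -
    have "real r * 2 ^ n * 4 \<le> real n * 2 ^ n * 4" using rn by simp
    also have "\<dots> = real (n * 2 ^ (n + 2))" by simp
    also have "\<dots> \<le> real Q" using Q(1) by (rule of_nat_mono)
    finally have "real r * 2 ^ n / real Q \<le> 1 / 4" using Q(2) by (simp add: field_simps)
    then have "?N * (real r * 2 ^ n / real Q) \<le> ?N * (1 / 4)" by (intro mult_left_mono) auto
    then show ?thesis by (simp add: mult_ac)
  qed
  finally have small: "(\<Sum>m\<in>?I. real (card (Small m))) \<le> ?N / 4" .
  have "(\<Sum>a<r. real (card (Large a))) \<le> (\<Sum>a<r. ?N * (real r / real s))"
  proof (rule sum_mono)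
    fix a assume a: "a \<in> {..<r}"
    have "fact (Suc a) * c ^ Suc a \<le> fact n * c ^ n"
      using a rn c by (intro mult_mono fact_mono power_increasing) auto
    then have "card (Large a) \<le> s ^ (n * r - 1) * r"
      unfolding Large_def using a rn s by (intro card_first_failure_le[OF L M1 s(2) _ _ rn b]) auto
    then have "real (card (Large a)) \<le> real (s ^ (n * r - 1) * r)" by (rule of_nat_mono)
    also have "\<dots> = ?N * (real r / real s)"
    proof -
      have "0 < n * r" using a rn by auto
      then have "?N = real s * real s ^ (n * r - 1)" by (simp add: power_eq_if)
      then show ?thesis using s0 by simp
    qed
    finally show "real (card (Large a)) \<le> ?N * (real r / real s)" .
  qed
  also have "\<dots> = ?N * (real r * real r / real s)" by simp
  also have "\<dots> \<le> ?N * (1 / 4)"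
  proof (rule mult_left_mono)
    have "real r * real r * 4 \<le> real n * real n * 4" using rn by (intro mult_right_mono mult_mono) auto
    also have "\<dots> = real (4 * n\<^sup>2)" by (simp add: power2_eq_square)
    also have "\<dots> \<le> real s" using s(4) by (rule of_nat_mono)
    finally show "real r * real r / real s \<le> 1 / 4" using s0 by (simp add: field_simps)
  qed simp
  finally have large: "(\<Sum>a<r. real (card (Large a))) \<le> ?N / 4" by simp
  have sub: "primitive_box n r s M L \<subseteq> entry_box n r s" by (auto simp: primitive_box_def)
  have "card (entry_box n r s - primitive_box n r s M L) = s ^ (n * r) - card (primitive_box n r s M L)"
    using card_Diff_subset[OF finite_subset[OF sub finite_entry_box] sub] card_entry_box by simp
  then have "?N - real (card (primitive_box n r s M L))
      \<le> real (card (entry_box n r s - primitive_box n r s M L))"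
    by (simp flip: of_nat_power)
  then show ?thesis using bad small large by linarith
qed

section \<open>Counting alternating matrices\<close>

text \<open>The spare 1 in the second bound absorbs the 1 in the diagonal shift \<open>L + 1\<close>
  and makes differences of entries strictly smaller than \<open>M * int s\<close>.\<close>

lemma shifted_bounds:
  assumes "y \<in> entry_box n r s" "i < n" "j < r" "1 \<le> M"
  shows "0 \<le> M * y (i, j)" and "M * y (i, j) + 1 \<le> M * int s"
proof -
  have y: "0 \<le> y (i, j)" "y (i, j) + 1 \<le> int s" using entry_box_range[OF assms(1-3)] by auto
  show "0 \<le> M * y (i, j)" using y assms(4) by simp
  have "M * (y (i, j) + 1) \<le> M * int s" using y assms(4) by (intro mult_left_mono) auto
  then show "M * y (i, j) + 1 \<le> M * int s" using assms(4) by (simp add: algebra_simps)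
qed

lemma abs_shifted_le:
  assumes "y \<in> entry_box n r s" "i < n" "j < r" "1 \<le> M"
  shows "\<bar>shifted M (int n * M * int s) y i j\<bar> \<le> (int n + 1) * M * int s"
proof -
  have "0 \<le> int n * M * int s" using assms(4) by simp
  moreover have "(int n + 1) * M * int s = int n * M * int s + M * int s"
    by (simp add: algebra_simps)
  ultimately show ?thesis using shifted_bounds[OF assms] by (auto simp: shifted_def)
qed

text \<open>The choice of \<open>L\<close> gives dominance with margin \<open>e = M * int s\<close>:
  at most \<open>n - 1\<close> off-diagonal entries of size \<open>e\<close>, plus \<open>e\<close>
  itself, stay below \<open>L\<close>.\<close>

lemma inj_on_skew_prod:
  assumes M: "1 < M" and hn: "2 * h < n" and L: "L = int n * M * int s"
  shows "inj_on (\<lambda>y. Matrix.mat n n (\<lambda>(i, j). skew_prod h (shifted M L y) i j))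
    (primitive_box n (2 * h) s M L)"
proof (rule inj_onI)
  fix y y' assume y: "y \<in> primitive_box n (2 * h) s M L" and y': "y' \<in> primitive_box n (2 * h) s M L"
    and eq: "Matrix.mat n n (\<lambda>(i, j). skew_prod h (shifted M L y) i j) =
      Matrix.mat n n (\<lambda>(i, j). skew_prod h (shifted M L y') i j)"
  let ?B = "shifted M L y" and ?B' = "shifted M L y'"
  have box: "y \<in> entry_box n (2 * h) s" "y' \<in> entry_box n (2 * h) s"
    using y y' by (simp_all add: primitive_box_def)
  have M1: "1 \<le> M" using M by simp
  have M_dvd: "M dvd L" by (simp add: L)
  have L0: "0 \<le> L" using M by (simp add: L)
  have same: "?B' i l = ?B i l" if il: "i < n" "l < 2 * h" for i l
  proof (rule skew_prod_eq_imp_eq[where e = "M * int s" and h = h and n = n])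
    show "skew_prod h ?B i j = skew_prod h ?B' i j" if "i < n" "j < n" for i j
      using arg_cong[OF eq, of "\<lambda>A. A $$ (i, j)"] that by simp
    show "2 * h \<le> n" using hn by simp
    show "Determinant.det (Matrix.mat (2 * h) (2 * h) (\<lambda>(i, j). ?B' i j)) \<noteq> 0"
      by (rule det_shifted_nonzero[OF M_dvd M])
    show "inj_mod d n (2 * h) ?B" if "d \<noteq> 0" for d
      by (rule inj_mod_if_prime[OF _ that]) (use y in \<open>simp add: primitive_box_def\<close>)
    show "(\<Sum>k\<in>{..<2 * h} - {i}. \<bar>?B i k\<bar>) + M * int s \<le> \<bar>?B i i\<bar>" if i: "i < 2 * h" for i
    proof -
      have "(\<Sum>k\<in>{..<2 * h} - {i}. \<bar>?B i k\<bar>) \<le> (\<Sum>k\<in>{..<2 * h} - {i}. M * int s)"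
      proof (rule sum_mono)
        fix k assume "k \<in> {..<2 * h} - {i}"
        then show "\<bar>?B i k\<bar> \<le> M * int s"
          using shifted_bounds[OF box(1) _ _ M1, of i k] i hn by (auto simp: shifted_def)
      qed
      then have "(\<Sum>k\<in>{..<2 * h} - {i}. \<bar>?B i k\<bar>) + M * int s \<le> int (2 * h - 1) * (M * int s) + M * int s"
        using i by simp
      also have "\<dots> = int (2 * h) * (M * int s)" using i by (simp add: of_nat_diff algebra_simps)
      also have "\<dots> \<le> int n * (M * int s)" using hn M by (intro mult_right_mono) auto
      also have "\<dots> = L" by (simp add: L)
      also have "\<dots> \<le> \<bar>?B i i\<bar>"
        using shifted_bounds[OF box(1) _ i M1, of i] i hn L0 by (simp add: shifted_def)
      finally show ?thesis .
    qed
    show "\<bar>?B' i j - ?B i j\<bar> < M * int s" if "i < 2 * h" "j < 2 * h" for i j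
      using shifted_bounds[OF box(1) _ that(2) M1, of i] shifted_bounds[OF box(2) _ that(2) M1, of i]
        that hn by (simp add: shifted_def)
  qed (use il in auto)
  show "y = y'"
  proof (rule PiE_ext[OF box[unfolded entry_box_def]])
    fix x assume "x \<in> {..<n} \<times> {..<2 * h}"
    then obtain i l where x: "x = (i, l)" "i < n" "l < 2 * h" by auto
    have "M * y' (i, l) = M * y (i, l)" using same[OF x(2,3)] by (simp add: shifted_def)
    then show "y x = y' x" using M x by simp
  qed
qed

lemma card_primitive_box_le_alt_rank_count:
  fixes T :: real
  assumes M: "1 < M" and hn: "2 * h < n" and L: "L = int n * M * int s"
    and T: "real n * (real n * (real_of_int ((int n + 1) * M * int s))\<^sup>2) < T"
  shows "card (primitive_box n (2 * h) s M L) \<le> alt_rank_count n (2 * h) T"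
proof -
  let ?A = "\<lambda>y. Matrix.mat n n (\<lambda>(i, j). skew_prod h (shifted M L y) i j)"
  let ?R = "{A \<in> alt_int_mats n. int_mat_rank A = 2 * h \<and> int_mat_norm A < T}"
  define b where "b = (int n + 1) * M * int s"
  have b0: "0 \<le> b" using M by (simp add: b_def)
  have M_dvd: "M dvd L" by (simp add: L)
  have "?A y \<in> ?R" if y: "y \<in> primitive_box n (2 * h) s M L" for y
  proof -
    have box: "y \<in> entry_box n (2 * h) s" using y by (simp add: primitive_box_def)
    have B: "\<bar>shifted M L y i j\<bar> \<le> b" if "i < n" "j < 2 * h" for i j
      unfolding L b_def using abs_shifted_le[OF box that] M by simp
    have "\<bar>skew_prod h (shifted M L y) i j\<bar> \<le> int n * b\<^sup>2" if "i < n" "j < n" for i j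
    proof -
      have bb: "\<bar>shifted M L y i k * shifted M L y j l\<bar> \<le> b\<^sup>2" if "k < 2 * h" "l < 2 * h" for k l
        unfolding abs_mult power2_eq_square using B that \<open>i < n\<close> \<open>j < n\<close> b0
        by (intro mult_mono) auto
      have "\<bar>skew_prod h (shifted M L y) i j\<bar> \<le> (\<Sum>k<h. 2 * b\<^sup>2)"
        unfolding skew_prod_def
      proof (rule order_trans[OF sum_abs sum_mono])
        fix k assume k: "k \<in> {..<h}"
        show "\<bar>shifted M L y i k * shifted M L y j (h + k) -
          shifted M L y i (h + k) * shifted M L y j k\<bar> \<le> 2 * b\<^sup>2"
          using bb[of k "h + k"] bb[of "h + k" k] k by simp
      qed
      also have "\<dots> = int (2 * h) * b\<^sup>2" by simp
      also have "\<dots> \<le> int n * b\<^sup>2" using hn by (intro mult_right_mono) auto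
      finally show ?thesis .
    qed
    then have "int_mat_norm (?A y) \<le> real n * real_of_int (int n * b\<^sup>2)"
      by (intro int_mat_norm_le) auto
    also have "\<dots> < T" using T by (simp add: b_def)
    finally show ?thesis
      using rank_skew_prod[OF _ det_shifted_nonzero[OF M_dvd M]] hn skew_prod_mat_alt by simp
  qed
  then have "?A ` primitive_box n (2 * h) s M L \<subseteq> ?R" by blast
  moreover have "finite ?R"
    by (rule finite_subset[OF _ finite_int_mat_norm_less[of n T]]) (auto simp: alt_int_mats_def)
  ultimately show ?thesis
    unfolding alt_rank_count_def by (intro card_inj_on_le[OF inj_on_skew_prod[OF M hn L]])
qed

theorem theorem9p5p1:
  fixes n :: nat
  assumes "n \<ge> 1"
  shows "\<exists>c::real. c > 0 \<and>
    (\<forall>r::nat. even r \<and> r \<le> n - 1 \<longrightarrow>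
      (\<forall>\<^sub>F T::real in at_top.
        real (alt_rank_count n r T) \<ge> c * T powr (real n * real r / 2)))"
proof -
  define Q where "Q = n * 2 ^ (n + 2)"
  define M where "M = (fact Q :: int)"
  define c where "c = (int n + 1) * M"
  \<comment> \<open>The norm of the matrix built from a box of side \<open>s\<close> is at most
    \<open>E * s\<^sup>2\<close>.\<close>
  define E where "E = real n * (real n * (real_of_int c)\<^sup>2)"
  define F where "F = 4 * (E + 1)"
  \<comment> \<open>Collects every lower bound on \<open>s\<close> that the box count
    requires.\<close>
  define S where "S = nat (fact n * c ^ n) + nat M + Q + 4 * n\<^sup>2 + 1"
  have "1 * 2 ^ 1 \<le> n * 2 ^ (n + 2)"
    using assms by (intro mult_mono power_increasing) auto
  then have Q2: "2 \<le> Q" by (simp add: Q_def)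
  have "int Q \<le> int (fact Q)" using fact_ge_self[of Q] by (rule of_nat_mono)
  then have M1: "1 < M" using Q2 unfolding M_def of_nat_fact by linarith
  have c1: "1 \<le> c" unfolding c_def using M1 mult_mono[of 1 "int n + 1" 1 M] by simp
  have E0: "0 \<le> E" by (simp add: E_def)
  have F1: "1 \<le> F" using E0 by (simp add: F_def)
  \<comment> \<open>The exponent of \<open>F\<close> uses \<open>n\<close> in place of
    \<open>r\<close>, so that the constant depends on \<open>n\<close> only; this is harmless as
    \<open>1 \<le> F\<close> and \<open>r < n\<close>.\<close>
  have "real (alt_rank_count n r T) \<ge> 1 / (2 * F powr (real n * real n / 2)) * T powr (real n * real r / 2)"
    if r: "even r" "r \<le> n - 1" and T: "T \<ge> (E + 1) * (real S + 1)\<^sup>2" for r T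
  proof -
    obtain h where h: "r = 2 * h" using r(1) by blast
    have rn: "r < n" using r(2) assms by linarith
    \<comment> \<open>Dividing by \<open>E + 1\<close> rather than \<open>E\<close> makes the norm
      bound strict: \<open>E * x\<^sup>2 < T\<close>.\<close>
    define x where "x = sqrt (T / (E + 1))"
    define s where "s = nat \<lfloor>x\<rfloor>"
    define L where "L = int n * M * int s"
    have T0: "0 < T"
      using T E0 by (smt (verit) mult_pos_pos of_nat_0_le_iff zero_less_power)
    have "(real S + 1)\<^sup>2 \<le> T / (E + 1)" using T E0 by (simp add: field_simps)
    then have xS: "real S + 1 \<le> x" unfolding x_def by (intro real_le_rsqrt)
    have x2: "x\<^sup>2 = T / (E + 1)" using T0 E0 by (simp add: x_def)
    have sx: "real s \<le> x" "x - 1 \<le> real s" using xS unfolding s_def by linarith+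
    have "real S \<le> real s" using sx xS by linarith
    then have Ss: "S \<le> s" by simp
    have nn: "0 \<le> fact n * c ^ n" "0 \<le> M" using c1 M1 by simp_all
    have s: "fact n * c ^ n < int s" "M \<le> int s" "Q \<le> s" "4 * n\<^sup>2 \<le> s"
      using Ss nn unfolding S_def by linarith+
    have "1 \<le> S" by (simp add: S_def)
    then have "2 \<le> x" using xS by linarith
    \<comment> \<open>Since \<open>2 \<le> x\<close>, rounding down costs at most a factor 2, which
      accounts for the 4 in \<open>F\<close>.\<close>
    then have xs: "x / 2 \<le> real s" using sx by linarith
    have count: "real s ^ (n * r) / 2 \<le> real (card (primitive_box n r s M L))"
      unfolding M_def
    proof (rule card_primitive_box_ge[where c = c])
      show "\<bar>shifted (fact Q) L y i j\<bar> \<le> c * int s"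
        if "y \<in> entry_box n r s" "i < n" "j < r" for y i j
        using abs_shifted_le[OF that, of M] M1 by (simp add: c_def L_def M_def)
    qed (use Q2 rn c1 s in \<open>auto simp: Q_def L_def M_def\<close>)
    have "E * (real s)\<^sup>2 \<le> E * x\<^sup>2" using sx E0 by (intro mult_left_mono power_mono) auto
    also have "\<dots> < T" using T0 E0 by (simp add: x2 field_simps)
    finally have "real n * (real n * (real_of_int ((int n + 1) * M * int s))\<^sup>2) < T"
      by (simp add: E_def c_def power_mult_distrib mult_ac)
    then have "card (primitive_box n r s M L) \<le> alt_rank_count n r T"
      unfolding h using rn by (intro card_primitive_box_le_alt_rank_count[OF M1 _ L_def]) (simp_all add: h)
    then have "real (card (primitive_box n r s M L)) \<le> real (alt_rank_count n r T)"
      by (rule of_nat_mono)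
    with count have "real s ^ (n * r) / 2 \<le> real (alt_rank_count n r T)" by linarith
    moreover have "(x / 2) ^ (n * r) \<le> real s ^ (n * r)"
      using xs \<open>2 \<le> x\<close> by (intro power_mono) auto
    moreover have "(x / 2) ^ (n * r) = T powr (real n * real r / 2) / F powr (real n * real r / 2)"
    proof -
      have "(x / 2)\<^sup>2 = T / F" unfolding power_divide x2 by (simp add: F_def)
      then have "sqrt (T / F) = x / 2" using \<open>2 \<le> x\<close> by (intro real_sqrt_unique) auto
      then have "x / 2 = (T / F) powr (1 / 2)"
        using T0 F1 by (subst powr_half_sqrt) auto
      then have "(x / 2) ^ (n * r) = ((T / F) powr (1 / 2)) powr real (n * r)"
        using T0 F1 by (subst powr_realpow) auto
      also have "\<dots> = (T / F) powr (real n * real r / 2)"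
        by (simp add: powr_powr)
      also have "\<dots> = T powr (real n * real r / 2) / F powr (real n * real r / 2)"
        by (rule powr_divide)
      finally show ?thesis .
    qed
    moreover have "T powr (real n * real r / 2) / F powr (real n * real n / 2)
        \<le> T powr (real n * real r / 2) / F powr (real n * real r / 2)"
      using F1 rn by (intro divide_left_mono powr_mono mult_left_mono divide_right_mono mult_pos_pos) auto
    ultimately show ?thesis by simp
  qed
  then have "\<forall>r. even r \<and> r \<le> n - 1 \<longrightarrow> (\<forall>\<^sub>F T in at_top. real (alt_rank_count n r T)
      \<ge> 1 / (2 * F powr (real n * real n / 2)) * T powr (real n * real r / 2))"
    unfolding eventually_at_top_linorder by blast
  moreover have "0 < 1 / (2 * F powr (real n * real n / 2))" using F1 by simp
  ultimately show ?thesis by blast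
qed

end
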